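(* Let $1\le k<d$ be integers. There is a constant $C>0$ such that for any embedding method $\hat u$ the following is true. For any $\varepsilon>0$, there is a surface $\mathcal{M}\subset\mathbb{R}^d$ which is the image $\phi(\mathcal{U})$ of a compact and convex domain $\mathcal{U}\subset\mathbb{R}^k$ with non-empty interior by a $C^2$ isometry $\phi$ defined on an open set containing $\mathcal{U}$, and a set of points $x_1,\dots,x_n$ belonging to $\mathcal{M}$ with $\max_{x\in\mathcal{M}}\min_{i=1,\dots,n}\|x-x_i\|\le\varepsilon$, such that, with $u_i:=\phi^{-1}(x_i)$, $$\min_{Q\in\mathbb{Q}_k}\ \max_{i\in\{1,\dots,n\}}\ \|\hat u_i-Q(u_i)\|\ \ge\ C^{-1}\varepsilon^2.$$
   Context: $\mathbb{Q}_k$ is the class of rigid transformations of $\mathbb{R}^k$ (orthogonal transformations composed with translations). Isometry means that the Euclidean distance on the convex domain $\mathcal{U}$ corresponds to the intrinsic distance (infimum of lengths of curves on the surface) on $\mathcal{M}$. An embedding method $\hat u$ is any map that takes as input a finite set of points $\{x_1,\dots,x_n\}\subset\mathbb{R}^d$ (together with the known values of $k$ and $\varepsilon$), but not the surface $\mathcal{M}$, and returns points $\hat u_1,\dots,\hat u_n\in\mathbb{R}^k$. *)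

theory Defs
  imports "HOL-Analysis.Analysis"
begin

text \<open>
  The length of a curve parametrised by \<open>[0,1]\<close> is the supremum of the lengths of its inscribed
  polygonal lines. It may be infinite.
\<close>

definition curve_length :: "(real \<Rightarrow> 'a::metric_space) \<Rightarrow> ennreal" where
  "curve_length g =
     (SUP (n, t) \<in> {(n::nat, t::nat \<Rightarrow> real). mono_on {..n} t \<and> t 0 = 0 \<and> t n = 1}.
        \<Sum>i<n. ennreal (dist (g (t i)) (g (t (Suc i)))))"

text \<open>The infimum of the empty set is \<open>\<infinity>\<close>, for points not joined by a curve inside \<open>M\<close>.\<close>

definition intrinsic_dist :: "'a::metric_space set \<Rightarrow> 'a \<Rightarrow> 'a \<Rightarrow> ennreal" where
  "intrinsic_dist M x y =
     (INF g \<in> {g. path g \<and> path_image g \<subseteq> M \<and> pathstart g = x \<and> pathfinish g = y}.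
        curve_length g)"

definition surface_isometry :: "'a::metric_space set \<Rightarrow> ('a \<Rightarrow> 'b::metric_space) \<Rightarrow> bool" where
  "surface_isometry U \<phi> \<longleftrightarrow>
     (\<forall>u\<in>U. \<forall>v\<in>U. intrinsic_dist (\<phi> ` U) (\<phi> u) (\<phi> v) = ennreal (dist u v))"

text \<open>Meant for open \<open>V\<close>: the derivatives are two-sided at every point of \<open>V\<close>.\<close>

definition C2_on :: "'a::real_normed_vector set \<Rightarrow> ('a \<Rightarrow> 'b::real_normed_vector) \<Rightarrow> bool" where
  "C2_on V f \<longleftrightarrow>
     (\<exists>(f' :: 'a \<Rightarrow> 'a \<Rightarrow>\<^sub>L 'b) (f'' :: 'a \<Rightarrow> 'a \<Rightarrow>\<^sub>L ('a \<Rightarrow>\<^sub>L 'b)).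
        (\<forall>x\<in>V. (f has_derivative blinfun_apply (f' x)) (at x)) \<and>
        (\<forall>x\<in>V. (f' has_derivative blinfun_apply (f'' x)) (at x)) \<and>
        continuous_on V f'')"

definition rigid_transformations :: "('a::real_inner \<Rightarrow> 'a) set" where
  "rigid_transformations = {Q. \<exists>A b. orthogonal_transformation A \<and> Q = (\<lambda>u. A u + b)}"

text \<open>
  The input set \<open>{x\<^sub>1, \<dots>, x\<^sub>n}\<close> is presented as a list without repetitions, so that the \<open>i\<close>-th output
  belongs to the \<open>i\<close>-th input point. The output may depend on the order of the list; a method
  that depends on the set alone is a special case. The dimensions \<open>k\<close> and \<open>d\<close> are known to the
  method through its type.
\<close>

definition embedding_method :: "(real \<Rightarrow> 'a list \<Rightarrow> 'b list) \<Rightarrow> bool" where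
  "embedding_method uh \<longleftrightarrow>
     (\<forall>\<epsilon>>0. \<forall>xs. distinct xs \<longrightarrow> length (uh \<epsilon> xs) = length xs)"

end

theory Submission
  imports Defs
begin

text \<open>
  The logarithmic spiral \<open>s \<mapsto> s exp (\<i> b ln (s / r)) / sqrt (1 + b\<^sup>2)\<close> has unit speed, but for large
  \<open>b\<close> an arbitrarily long piece of it fits into a small ball. The cylinder over it is an isometric
  image of a slab of \<open>\<real>\<^sup>k\<close>. When \<open>b\<close> is tuned so that two points of the spiral lie on the same
  ray, the same two points also lie on a flat slab (the case \<open>b = 0\<close>), where their distance is much
  smaller. Both surfaces lie within \<open>\<epsilon>\<close> of one of these points, so the method sees the same two-point
  sample for both and must misjudge one of the two distances.
\<close>

section \<open>Curve lengths and the intrinsic distance of a smoothly parametrised image\<close>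

lemma curve_length_ge:
  assumes "mono_on {..n} t" "t 0 = 0" "t n = 1"
  shows "ennreal (\<Sum>i<n. dist (g (t i)) (g (t (Suc i)))) \<le> curve_length g"
proof -
  have "ennreal (\<Sum>i<n. dist (g (t i)) (g (t (Suc i)))) = (\<Sum>i<n. ennreal (dist (g (t i)) (g (t (Suc i)))))"
    by (simp add: sum_ennreal)
  also have "\<dots> \<le> curve_length g"
    unfolding curve_length_def
    by (rule SUP_upper2[where i = "(n, t)"]) (use assms in auto)
  finally show ?thesis .
qed

lemma curve_length_le_lipschitz:
  assumes lip: "\<And>x y. \<lbrakk>0 \<le> x; x \<le> y; y \<le> 1\<rbrakk> \<Longrightarrow> dist (g x) (g y) \<le> B * (y - x)"
  shows "curve_length g \<le> ennreal B"
  unfolding curve_length_def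
proof (rule SUP_least, clarify)
  fix n :: nat and t :: "nat \<Rightarrow> real"
  assume t: "mono_on {..n} t" "t 0 = 0" "t n = 1"
  have "(\<Sum>i<n. dist (g (t i)) (g (t (Suc i)))) \<le> (\<Sum>i<n. B * (t (Suc i) - t i))"
  proof (rule sum_mono)
    fix i assume "i \<in> {..<n}"
    then have "t 0 \<le> t i" "t i \<le> t (Suc i)" "t (Suc i) \<le> t n"
      by (auto intro!: mono_onD[OF t(1)])
    then show "dist (g (t i)) (g (t (Suc i))) \<le> B * (t (Suc i) - t i)"
      by (intro lip) (use t in auto)
  qed
  also have "\<dots> = B"
    by (simp add: sum_distrib_left[symmetric] sum_lessThan_telescope t)
  finally show "(\<Sum>i<n. ennreal (dist (g (t i)) (g (t (Suc i))))) \<le> ennreal B"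
    by (simp add: sum_ennreal ennreal_leI)
qed

lemma dist_le_sum_dist:
  "dist (f 0) (f n) \<le> (\<Sum>i<n. dist (f i) (f (Suc i)))" for f :: "nat \<Rightarrow> 'a::metric_space"
proof (induction n)
  case (Suc n)
  then show ?case
    using dist_triangle[of "f 0" "f (Suc n)" "f n"] by simp
qed simp

text \<open>By compactness \<open>f'\<close> is uniformly continuous, so along a short segment from
  \<open>x\<close> the map differs from its linearization at \<open>x\<close> by at most \<eta>
  times the length, while \<open>f' x\<close> preserves norms. The bound compares short chords of a
  curve in the image with those of its lift to \<open>U\<close>.\<close>

lemma almost_isometric_at_small_scale:
  fixes f :: "'a::real_normed_vector \<Rightarrow> 'b::real_normed_vector"
  assumes U: "compact U" "convex U"
    and f: "\<And>x. x \<in> U \<Longrightarrow> (f has_derivative blinfun_apply (f' x)) (at x within U)"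
    and cont: "continuous_on U f'"
    and iso: "\<And>x h. x \<in> U \<Longrightarrow> norm (f' x h) = norm h"
    and "0 < \<eta>"
  obtains \<delta> where "0 < \<delta>"
    "\<And>x y. \<lbrakk>x \<in> U; y \<in> U; dist x y < \<delta>\<rbrakk> \<Longrightarrow> (1 - \<eta>) * dist x y \<le> dist (f x) (f y)"
proof -
  have "uniformly_continuous_on U f'"
    using cont U(1) by (rule compact_uniformly_continuous)
  then obtain \<delta> where \<delta>: "0 < \<delta>"
    "\<And>x y. \<lbrakk>x \<in> U; y \<in> U; dist x y < \<delta>\<rbrakk> \<Longrightarrow> dist (f' x) (f' y) < \<eta>"
    using \<open>0 < \<eta>\<close> unfolding uniformly_continuous_on_def by (metis dist_commute)
  have "(1 - \<eta>) * dist x y \<le> dist (f x) (f y)"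
    if xy: "x \<in> U" "y \<in> U" "dist x y < \<delta>" for x y
  proof -
    have seg: "closed_segment x y \<subseteq> U"
      using xy U(2) by (simp add: closed_segment_subset)
    have "norm (f y - f x - f' x (y - x)) \<le> norm (y - x) * \<eta>"
    proof (rule differentiable_bound_linearization)
      show "x + t *\<^sub>R (y - x) \<in> closed_segment x y" if "t \<in> {0..1}" for t
        using that unfolding closed_segment_def by (auto intro!: exI[of _ t] simp: algebra_simps)
      show "(f has_derivative blinfun_apply (f' z)) (at z within closed_segment x y)"
        if "z \<in> closed_segment x y" for z
        using f[of z] that seg has_derivative_subset by blast
      show "onorm (blinfun_apply (f' z) - blinfun_apply (f' x)) \<le> \<eta>" if "z \<in> closed_segment x y" for z
      proof -
        have "dist z x < \<delta>"
          using segment_bound(1)[OF that] xy(3) by (simp add: dist_norm norm_minus_commute)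
        then have "norm (f' z - f' x) \<le> \<eta>"
          using \<delta>(2)[of z x] that seg xy by (auto simp: dist_norm less_imp_le)
        then show ?thesis
          by (simp add: norm_blinfun.rep_eq minus_blinfun.rep_eq fun_diff_def)
      qed
    qed auto
    moreover have "norm (f' x (y - x)) \<le> norm (f y - f x) + norm (f y - f x - f' x (y - x))"
      using norm_triangle_ineq4[of "f y - f x" "f y - f x - f' x (y - x)"] by simp
    ultimately show ?thesis
      using iso[OF xy(1), of "y - x"] by (simp add: dist_norm norm_minus_commute algebra_simps)
  qed
  with \<delta>(1) show ?thesis by (rule that)
qed

text \<open>A competing curve \<open>g\<close> is only continuous and cannot be differentiated. It
  is lifted to \<open>U\<close> and cut so finely that each chord of \<open>g\<close> is at least
  \<open>z\<close> times the matching chord of the lift. The lifted chords add up to at least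
  \<open>dist u v\<close>, and \<open>z < 1\<close> is arbitrary.\<close>

lemma dist_le_curve_length:
  fixes f :: "'a::real_normed_vector \<Rightarrow> 'b::real_normed_vector"
  assumes U: "compact U" "convex U"
    and f: "\<And>x. x \<in> U \<Longrightarrow> (f has_derivative blinfun_apply (f' x)) (at x within U)"
    and cont: "continuous_on U f'"
    and iso: "\<And>x h. x \<in> U \<Longrightarrow> norm (f' x h) = norm h"
    and inj: "inj_on f U"
    and g: "path g" "path_image g \<subseteq> f ` U" "pathstart g = f u" "pathfinish g = f v"
    and uv: "u \<in> U" "v \<in> U"
  shows "ennreal (dist u v) \<le> curve_length g"
proof -
  \<comment> \<open>The lift is continuous because a continuous injection of a compact set has a
    continuous inverse.\<close>
  define h where "h = inv_into U f \<circ> g"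
  have "continuous_on (f ` U) (inv_into U f)"
    using U(1) has_derivative_continuous_on[of U f, OF f] inj
    by (intro continuous_on_inv) auto
  then have "path h"
    using g(1,2) unfolding h_def path_def path_image_def
    by (intro continuous_on_compose) (auto intro: continuous_on_subset)
  then have "uniformly_continuous_on {0..1} h"
    by (simp add: path_def compact_uniformly_continuous)
  have hU: "h x \<in> U" "f (h x) = g x" if "x \<in> {0..1}" for x
    using that g(2) unfolding h_def path_image_def
    by (auto simp: inv_into_into f_inv_into_f subset_iff)
  have h01: "h 0 = u" "h 1 = v"
    using g(3,4) uv inj by (auto simp: h_def pathstart_def pathfinish_def)
  have *: "ennreal (z * dist u v) \<le> curve_length g" if z: "0 < z" "z < 1" for z
  proof -
    obtain \<delta> where \<delta>: "0 < \<delta>"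
      "\<And>x y. \<lbrakk>x \<in> U; y \<in> U; dist x y < \<delta>\<rbrakk> \<Longrightarrow> z * dist x y \<le> dist (f x) (f y)"
      using almost_isometric_at_small_scale[OF U f cont iso, of "1 - z"] z by auto
    obtain \<rho> where \<rho>: "0 < \<rho>"
      "\<And>x y. \<lbrakk>x \<in> {0..1}; y \<in> {0..1}; dist x y < \<rho>\<rbrakk> \<Longrightarrow> dist (h x) (h y) < \<delta>"
      using \<open>uniformly_continuous_on {0..1} h\<close> \<delta>(1)
      unfolding uniformly_continuous_on_def by (metis dist_commute)
    obtain n where n: "inverse (real (Suc n)) < \<rho>"
      using reals_Archimedean[OF \<rho>(1)] by auto
    \<comment> \<open>Equal steps of length \<open>1 / Suc n\<close>, below the modulus \<rho> of
      uniform continuity of the lift.\<close>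
    define t where "t i = real i / real (Suc n)" for i
    have t01: "t i \<in> {0..1}" if "i \<le> Suc n" for i
      using that by (auto simp: t_def)
    have "z * dist u v = z * dist (h (t 0)) (h (t (Suc n)))"
      by (simp add: t_def h01)
    also have "\<dots> \<le> z * (\<Sum>i<Suc n. dist (h (t i)) (h (t (Suc i))))"
      using dist_le_sum_dist[of "h \<circ> t" "Suc n"] z by (intro mult_left_mono) auto
    also have "\<dots> = (\<Sum>i<Suc n. z * dist (h (t i)) (h (t (Suc i))))"
      by (rule sum_distrib_left)
    also have "\<dots> \<le> (\<Sum>i<Suc n. dist (g (t i)) (g (t (Suc i))))"
    proof (rule sum_mono)
      fix i assume "i \<in> {..<Suc n}"
      then have i: "t i \<in> {0..1}" "t (Suc i) \<in> {0..1}"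
        using t01[of i] t01[of "Suc i"] by auto
      have "t (Suc i) - t i = inverse (real (Suc n))"
        by (simp add: t_def divide_simps)
      then have "dist (t i) (t (Suc i)) < \<rho>"
        using n positive_imp_inverse_positive[of "real (Suc n)"] unfolding dist_real_def by linarith
      then have "dist (h (t i)) (h (t (Suc i))) < \<delta>"
        using i by (intro \<rho>(2))
      then show "z * dist (h (t i)) (h (t (Suc i))) \<le> dist (g (t i)) (g (t (Suc i)))"
        using \<delta>(2)[of "h (t i)" "h (t (Suc i))"] hU i by simp
    qed
    finally have "ennreal (z * dist u v) \<le> ennreal (\<Sum>i<Suc n. dist (g (t i)) (g (t (Suc i))))"
      by (rule ennreal_leI)
    also have "\<dots> \<le> curve_length g"
      by (rule curve_length_ge) (auto simp: t_def mono_on_def divide_simps)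
    finally show ?thesis .
  qed
  show ?thesis
  \<comment> \<open>An infinite length satisfies the bound trivially; for a finite one
    \<open>z\<close> tends to 1 within the reals.\<close>
  proof (cases "curve_length g")
    case (real l)
    have "z * dist u v \<le> l" if "0 < z" "z < 1" for z
      using *[OF that] unfolding real(2) by (simp only: ennreal_le_iff[OF real(1)])
    then have "dist u v \<le> l"
      by (rule field_le_mult_one_interval)
    then show ?thesis
      using real by (simp add: ennreal_leI)
  qed simp
qed

text \<open>The image of the straight segment is short enough because \<open>f\<close> is
  1-Lipschitz on the convex set \<open>U\<close>; no curve is shorter by
  \<open>dist_le_curve_length\<close>. \<open>D\<close> lets an explicit formula stand for the
  derivative that \<open>C2_on\<close> provides only existentially.\<close>

lemma surface_isometryI:
  fixes f :: "'a::real_normed_vector \<Rightarrow> 'b::real_normed_vector"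
  assumes U: "compact U" "convex U" "open V" "U \<subseteq> V"
    and "C2_on V f" and inj: "inj_on f U"
    and D: "\<And>x. x \<in> U \<Longrightarrow> (f has_derivative D x) (at x)"
    and iso: "\<And>x h. x \<in> U \<Longrightarrow> norm (D x h) = norm h"
  shows "surface_isometry U f"
proof -
  obtain f' f'' where
    f': "\<And>x. x \<in> V \<Longrightarrow> (f has_derivative blinfun_apply (f' x)) (at x)" and
    f'': "\<And>x. x \<in> V \<Longrightarrow> (f' has_derivative blinfun_apply (f'' x)) (at x)"
    using \<open>C2_on V f\<close> unfolding C2_on_def by blast
  have f: "(f has_derivative blinfun_apply (f' x)) (at x within U)" if "x \<in> U" for x
    using f' that U by (auto intro: has_derivative_at_withinI)
  have cont: "continuous_on U f'"
    using f'' U by (intro has_derivative_continuous_on[of U f']) (auto intro: has_derivative_at_withinI)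
  have iso': "norm (f' x h) = norm h" if "x \<in> U" for x h
  proof -
    have "blinfun_apply (f' x) = D x"
      using has_derivative_unique[OF f' D] that U by auto
    then show ?thesis
      using iso that by simp
  qed
  have "onorm (f' x) \<le> 1" if "x \<in> U" for x
    using that by (intro onorm_bound) (simp_all add: iso')
  then have lip: "dist (f x) (f y) \<le> dist x y" if "x \<in> U" "y \<in> U" for x y
    using differentiable_bound[OF \<open>convex U\<close> f, of 1 y x] that
    by (simp add: dist_norm norm_minus_commute)
  have contf: "continuous_on U f"
    using f by (rule has_derivative_continuous_on)
  show ?thesis
    unfolding surface_isometry_def
  proof (intro ballI antisym)
    fix u v assume uv: "u \<in> U" "v \<in> U"
    have seg: "closed_segment u v \<subseteq> U"
      using uv \<open>convex U\<close> by (simp add: closed_segment_subset)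
    then have in_U: "linepath u v x \<in> U" if "x \<in> {0..1}" for x
      using that linepath_in_path by blast
    have "curve_length (f \<circ> linepath u v) \<le> ennreal (dist u v)"
    proof (rule curve_length_le_lipschitz)
      fix x y :: real assume "0 \<le> x" "x \<le> y" "y \<le> 1"
      moreover have "linepath u v x - linepath u v y = (y - x) *\<^sub>R (u - v)"
        by (simp add: linepath_def algebra_simps)
      ultimately show "dist ((f \<circ> linepath u v) x) ((f \<circ> linepath u v) y) \<le> dist u v * (y - x)"
        using lip[of "linepath u v x" "linepath u v y"] in_U by (simp add: dist_norm mult.commute)
    qed
    moreover have "path (f \<circ> linepath u v)"
      using contf seg by (intro path_continuous_image) (auto intro: continuous_on_subset)
    ultimately show "intrinsic_dist (f ` U) (f u) (f v) \<le> ennreal (dist u v)"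
      unfolding intrinsic_dist_def using seg
      by (intro INF_lower2[where i = "f \<circ> linepath u v"])
        (auto simp: path_image_compose pathstart_compose pathfinish_compose)
    show "ennreal (dist u v) \<le> intrinsic_dist (f ` U) (f u) (f v)"
      unfolding intrinsic_dist_def
      using dist_le_curve_length[OF U(1,2) f cont iso' inj _ _ _ _ uv] by (intro INF_greatest) auto
  qed
qed

section \<open>Building blocks of twice continuously differentiable maps\<close>

lemma C2_on_add:
  assumes "C2_on V f" "C2_on V g"
  shows "C2_on V (\<lambda>x. f x + g x)"
proof -
  obtain f' f'' g' g'' where
    "\<forall>x\<in>V. (f has_derivative blinfun_apply (f' x)) (at x)"
    "\<forall>x\<in>V. (f' has_derivative blinfun_apply (f'' x)) (at x)" "continuous_on V f''"
    "\<forall>x\<in>V. (g has_derivative blinfun_apply (g' x)) (at x)"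
    "\<forall>x\<in>V. (g' has_derivative blinfun_apply (g'' x)) (at x)" "continuous_on V g''"
    using assms unfolding C2_on_def by blast
  then show ?thesis
    unfolding C2_on_def
    by (intro exI[of _ "\<lambda>x. f' x + g' x"] exI[of _ "\<lambda>x. f'' x + g'' x"])
      (auto simp: plus_blinfun.rep_eq intro!: has_derivative_add continuous_on_add)
qed

lemma C2_on_bounded_linear:
  assumes "bounded_linear f"
  shows "C2_on V f"
  unfolding C2_on_def
  by (intro exI[of _ "\<lambda>x. Blinfun f"] exI[of _ "\<lambda>x. 0"])
    (auto simp: bounded_linear_Blinfun_apply[OF assms] bounded_linear_imp_has_derivative[OF assms]
       zero_blinfun.rep_eq)

text \<open>The derivative of a ridge function is again a ridge function, with profile
  \<open>p'\<close> and the bounded linear map \<open>B\<close> in the place of \<open>z\<close>.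
  Hence one chain rule, \<open>ridge\<close>, stated for any target space, serves both
  orders.\<close>

lemma C2_on_ridge:
  fixes a :: "'a::real_inner" and z :: "'b::real_normed_vector" and p :: "real \<Rightarrow> real"
  assumes p: "\<And>s. s \<in> S \<Longrightarrow> (p has_real_derivative p' s) (at s)"
    and p': "\<And>s. s \<in> S \<Longrightarrow> (p' has_real_derivative p'' s) (at s)"
    and p'': "continuous_on S p''"
  shows "C2_on {u. u \<bullet> a \<in> S} (\<lambda>u. p (u \<bullet> a) *\<^sub>R z)"
proof -
  have bl: "bounded_linear (\<lambda>u::'a. (u \<bullet> a) *\<^sub>R w)" for w :: "'c::real_normed_vector"
    by (intro bounded_linear_intros)
  define B where "B = Blinfun (\<lambda>u::'a. (u \<bullet> a) *\<^sub>R z)"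
  define B2 where "B2 = Blinfun (\<lambda>u::'a. (u \<bullet> a) *\<^sub>R B)"
  have B: "blinfun_apply B h = (h \<bullet> a) *\<^sub>R z" and B2: "blinfun_apply B2 h = (h \<bullet> a) *\<^sub>R B" for h
    by (simp_all add: B_def B2_def bounded_linear_Blinfun_apply[OF bl])
  have ridge: "((\<lambda>u. f (u \<bullet> a) *\<^sub>R w) has_derivative (\<lambda>h. f' *\<^sub>R (h \<bullet> a) *\<^sub>R w)) (at u)"
    if "(f has_real_derivative f') (at (u \<bullet> a))"
    for f :: "real \<Rightarrow> real" and f' u and w :: "'c::real_normed_vector"
  proof -
    have "((\<lambda>u. f (u \<bullet> a)) has_derivative (\<lambda>h. f' * (h \<bullet> a))) (at u)"
      using that unfolding has_field_derivative_def
      by (intro has_derivative_compose[where f = "\<lambda>u. u \<bullet> a" and g = f])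
        (auto intro!: derivative_eq_intros)
    from has_derivative_scaleR_left[OF this, of w] show ?thesis
      by simp
  qed
  show ?thesis
    unfolding C2_on_def
  proof (intro exI[of _ "\<lambda>u. p' (u \<bullet> a) *\<^sub>R B"] exI[of _ "\<lambda>u. p'' (u \<bullet> a) *\<^sub>R B2"] conjI ballI)
    fix u assume "u \<in> {u. u \<bullet> a \<in> S}"
    then have u: "u \<bullet> a \<in> S" by simp
    show "((\<lambda>u. p (u \<bullet> a) *\<^sub>R z) has_derivative blinfun_apply (p' (u \<bullet> a) *\<^sub>R B)) (at u)"
      using ridge[OF p[OF u], of z] by (simp add: scaleR_blinfun.rep_eq B)
    show "((\<lambda>u. p' (u \<bullet> a) *\<^sub>R B) has_derivative blinfun_apply (p'' (u \<bullet> a) *\<^sub>R B2)) (at u)"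
      using ridge[OF p'[OF u], of B] by (simp add: scaleR_blinfun.rep_eq B2)
  next
    show "continuous_on {u. u \<bullet> a \<in> S} (\<lambda>u. p'' (u \<bullet> a) *\<^sub>R B2)"
      by (intro continuous_intros continuous_on_compose2[OF p'']) auto
  qed
qed

section \<open>Slabs: an interval along a unit vector times a ball in its orthogonal
  complement\<close>

definition slab :: "'a::real_inner \<Rightarrow> real \<Rightarrow> real \<Rightarrow> real \<Rightarrow> 'a set" where
  "slab a l m h = {u. l \<le> u \<bullet> a \<and> u \<bullet> a \<le> m \<and> norm (u - (u \<bullet> a) *\<^sub>R a) \<le> h}"

lemma convex_slab: "convex (slab a l m h)"
proof -
  have lin: "linear (\<lambda>u. u - (u \<bullet> a) *\<^sub>R a)" "linear (\<lambda>u. u \<bullet> a)"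
    by (auto intro!: linearI simp: algebra_simps inner_add_left)
  have "slab a l m h = (\<lambda>u. u - (u \<bullet> a) *\<^sub>R a) -` cball 0 h \<inter> (\<lambda>u. u \<bullet> a) -` {l..m}"
    by (auto simp: slab_def)
  then show ?thesis
    using lin by (auto intro!: convex_Int convex_linear_vimage)
qed

lemma compact_slab: "compact (slab a l m h)" for a :: "'a::euclidean_space"
proof -
  have "bounded (slab a l m h)"
    unfolding bounded_iff
  proof (intro exI ballI)
    fix u assume "u \<in> slab a l m h"
    then have "norm (u - (u \<bullet> a) *\<^sub>R a) \<le> h" "\<bar>u \<bullet> a\<bar> \<le> max \<bar>l\<bar> \<bar>m\<bar>"
      by (auto simp: slab_def)
    then have "norm (u - (u \<bullet> a) *\<^sub>R a) + \<bar>u \<bullet> a\<bar> * norm a \<le> h + max \<bar>l\<bar> \<bar>m\<bar> * norm a"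
      by (intro add_mono mult_right_mono) auto
    then show "norm u \<le> h + max \<bar>l\<bar> \<bar>m\<bar> * norm a"
      using norm_triangle_ineq[of "u - (u \<bullet> a) *\<^sub>R a" "(u \<bullet> a) *\<^sub>R a"] by simp
  qed
  moreover have "closed (slab a l m h)"
    unfolding slab_def by (intro closed_Collect_conj closed_Collect_le continuous_intros)
  ultimately show ?thesis
    by (simp add: compact_eq_bounded_closed)
qed

lemma interior_slab_nonempty:
  assumes "norm a = 1" "l < m" "0 < h"
  shows "interior (slab a l m h) \<noteq> {}"
proof -
  let ?S = "{u. l < u \<bullet> a \<and> u \<bullet> a < m \<and> norm (u - (u \<bullet> a) *\<^sub>R a) < h}"
  have "open ?S"
    by (intro open_Collect_conj open_Collect_less continuous_intros)
  then have "?S \<subseteq> interior (slab a l m h)"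
    by (intro interior_maximal) (auto simp: slab_def)
  moreover have "((l + m) / 2) *\<^sub>R a \<in> ?S"
    using assms by (simp add: dot_square_norm)
  ultimately show ?thesis by blast
qed

section \<open>Distance distortion as an obstruction to rigid alignment\<close>

lemma rigid_fit_error_ge:
  fixes f :: "'a \<Rightarrow> 'b::real_inner"
  shows "\<bar>dist (y ! 0) (y ! 1) - dist (f x1) (f x2)\<bar> / 2 \<le>
    (INF Q\<in>rigid_transformations. MAX i\<in>{..<length [x1, x2]}. norm (y ! i - Q (f ([x1, x2] ! i))))"
proof (rule cINF_greatest)
  have "orthogonal_transformation (\<lambda>u::'b. u)"
    by (simp add: orthogonal_transformation_def linear_iff)
  then show "(rigid_transformations :: ('b \<Rightarrow> 'b) set) \<noteq> {}"
    unfolding rigid_transformations_def by blast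
next
  fix Q :: "'b \<Rightarrow> 'b" assume "Q \<in> rigid_transformations"
  then obtain A b where A: "orthogonal_transformation A" and Q: "Q = (\<lambda>u. A u + b)"
    unfolding rigid_transformations_def by blast
  have "dist (Q (f x1)) (Q (f x2)) = dist (f x1) (f x2)"
    using orthogonal_transformation_norm[OF A, of "f x1 - f x2"]
    by (simp add: Q dist_norm linear_diff[OF orthogonal_transformation_linear[OF A]])
  \<comment> \<open>Since \<open>Q\<close> preserves distances, an error in the distance must be
    paid at the two points together, and the larger payment is at least half of it. Two triangle
    inequalities serve each sign of the difference.\<close>
  then have "\<bar>dist (y ! 0) (y ! 1) - dist (f x1) (f x2)\<bar> \<le> dist (y ! 0) (Q (f x1)) + dist (y ! 1) (Q (f x2))"
    using dist_triangle[of "y ! 0" "y ! 1" "Q (f x1)"] dist_triangle[of "Q (f x1)" "y ! 1" "Q (f x2)"]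
      dist_triangle[of "Q (f x1)" "Q (f x2)" "y ! 0"] dist_triangle[of "y ! 0" "Q (f x2)" "y ! 1"]
    by (simp add: dist_commute)
  moreover have "{..<length [x1, x2]} = {0, 1::nat}"
    by auto
  ultimately show "\<bar>dist (y ! 0) (y ! 1) - dist (f x1) (f x2)\<bar> / 2 \<le>
      (MAX i\<in>{..<length [x1, x2]}. norm (y ! i - Q (f ([x1, x2] ! i))))"
    by (simp add: dist_norm max_def)
qed

section \<open>The logarithmic spiral\<close>

definition spiral_x :: "real \<Rightarrow> real \<Rightarrow> real \<Rightarrow> real" where
  "spiral_x b r s = s * cos (b * ln (s / r)) / sqrt (1 + b\<^sup>2)"

text \<open>The angle vanishes at \<open>s = r\<close>, so \<open>r\<close> sets the phase. For
  \<open>b = 0\<close> the curve is the first axis at unit speed, so the flat surface needs no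
  construction of its own.\<close>

definition spiral_y :: "real \<Rightarrow> real \<Rightarrow> real \<Rightarrow> real" where
  "spiral_y b r s = s * sin (b * ln (s / r)) / sqrt (1 + b\<^sup>2)"

lemma sqrt_one_plus_square_pos: "0 < sqrt (1 + b\<^sup>2)"
  by (simp add: add_pos_nonneg)

lemma one_plus_square_neq_0: "1 + b\<^sup>2 \<noteq> 0" for b :: real
  using sqrt_one_plus_square_pos[of b] by auto

lemma spiral_x_deriv:
  assumes "0 < s" "0 < r"
  shows "(spiral_x b r has_real_derivative
    (cos (b * ln (s / r)) - b * sin (b * ln (s / r))) / sqrt (1 + b\<^sup>2)) (at s)"
  unfolding spiral_x_def[abs_def]
  by (rule DERIV_cdivide) (use assms in \<open>auto intro!: derivative_eq_intros simp: field_simps\<close>)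

lemma spiral_y_deriv:
  assumes "0 < s" "0 < r"
  shows "(spiral_y b r has_real_derivative
    (sin (b * ln (s / r)) + b * cos (b * ln (s / r))) / sqrt (1 + b\<^sup>2)) (at s)"
  unfolding spiral_y_def[abs_def]
  by (rule DERIV_cdivide) (use assms in \<open>auto intro!: derivative_eq_intros simp: field_simps\<close>)

lemma spiral_x_deriv2:
  assumes "0 < s" "0 < r"
  shows "((\<lambda>s. (cos (b * ln (s / r)) - b * sin (b * ln (s / r))) / sqrt (1 + b\<^sup>2)) has_real_derivative
    (- b * sin (b * ln (s / r)) - b\<^sup>2 * cos (b * ln (s / r))) / s / sqrt (1 + b\<^sup>2)) (at s)"
  by (rule DERIV_cdivide) (use assms in \<open>auto intro!: derivative_eq_intros simp: field_simps power2_eq_square\<close>)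

lemma spiral_y_deriv2:
  assumes "0 < s" "0 < r"
  shows "((\<lambda>s. (sin (b * ln (s / r)) + b * cos (b * ln (s / r))) / sqrt (1 + b\<^sup>2)) has_real_derivative
    (b * cos (b * ln (s / r)) - b\<^sup>2 * sin (b * ln (s / r))) / s / sqrt (1 + b\<^sup>2)) (at s)"
  by (rule DERIV_cdivide) (use assms in \<open>auto intro!: derivative_eq_intros simp: field_simps power2_eq_square\<close>)

text \<open>The rotation drops out. As the radius grows with \<open>s > 0\<close>, the spiral is
  injective however tightly it winds.\<close>

lemma spiral_radius: "(spiral_x b r s)\<^sup>2 + (spiral_y b r s)\<^sup>2 = s\<^sup>2 / (1 + b\<^sup>2)"
proof -
  have "(s * x / k)\<^sup>2 + (s * y / k)\<^sup>2 = s\<^sup>2 * (x\<^sup>2 + y\<^sup>2) / k\<^sup>2" for x y k :: real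
    by (simp add: power_divide power_mult_distrib add_divide_distrib distrib_left)
  from this[of "cos (b * ln (s / r))" "sqrt (1 + b\<^sup>2)" "sin (b * ln (s / r))"] show ?thesis
    by (simp add: spiral_x_def spiral_y_def)
qed

text \<open>The vector is the unit vector \<open>(1, b) / sqrt (1 + b\<^sup>2)\<close> turned by the
  angle \<open>t\<close>. With \<open>t = b * ln (s / r)\<close> it is the velocity of the
  spiral.\<close>

lemma spiral_unit_speed:
  "((cos t - b * sin t) / sqrt (1 + b\<^sup>2))\<^sup>2 + ((sin t + b * cos t) / sqrt (1 + b\<^sup>2))\<^sup>2 = 1"
proof -
  have "(x - b * y)\<^sup>2 + (y + b * x)\<^sup>2 = (1 + b\<^sup>2) * (x\<^sup>2 + y\<^sup>2)" for x y :: real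
    by (simp add: power2_eq_square algebra_simps)
  from this[of "cos t" "sin t"] show ?thesis
    by (simp add: one_plus_square_neq_0 power_divide add_divide_distrib[symmetric])
qed

lemma abs_spiral_le:
  assumes "0 \<le> s"
  shows "\<bar>spiral_x b r s\<bar> \<le> s / sqrt (1 + b\<^sup>2)" "\<bar>spiral_y b r s\<bar> \<le> s / sqrt (1 + b\<^sup>2)"
  using assms sqrt_one_plus_square_pos[of b] unfolding spiral_x_def spiral_y_def
  by (auto simp: abs_mult abs_divide intro!: divide_right_mono mult_left_le)

section \<open>Cylinders over plane curves\<close>

locale cylinder_frame =
  fixes L :: "'a::euclidean_space \<Rightarrow> 'b::euclidean_space" and w :: 'b and a :: 'a
  assumes linear_L: "linear L" and norm_L: "\<And>x. norm (L x) = norm x"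
    and orth: "\<And>x. w \<bullet> L x = 0" and norm_w: "norm w = 1" and norm_a: "norm a = 1"
begin

sublocale L: linear L
  by (rule linear_L)

text \<open>\<open>L\<close> places the parameter space in the hyperplane orthogonal to
  \<open>w\<close>. Only the direction \<open>a\<close> is bent: its coordinate runs along the curve
  \<open>(p, q)\<close> in the plane of \<open>L a\<close> and \<open>w\<close>, and the complement
  of \<open>a\<close> stays straight.\<close>

definition cylinder :: "(real \<Rightarrow> real) \<Rightarrow> (real \<Rightarrow> real) \<Rightarrow> 'a \<Rightarrow> 'b" where
  "cylinder p q u = L (u - (u \<bullet> a) *\<^sub>R a) + p (u \<bullet> a) *\<^sub>R L a + q (u \<bullet> a) *\<^sub>R w"

text \<open>Pythagoras twice: in the domain, where the first part is orthogonal to \<open>a\<close>,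
  and in the target, where \<open>w\<close> is orthogonal to the range of \<open>L\<close>. The
  shape fits both the derivative of a cylinder and the difference of two of its values.\<close>

lemma norm_frame:
  "(norm (L (y - (y \<bullet> a) *\<^sub>R a) + s *\<^sub>R L a + t *\<^sub>R w))\<^sup>2 = (norm (y - (y \<bullet> a) *\<^sub>R a))\<^sup>2 + s\<^sup>2 + t\<^sup>2"
proof -
  let ?y = "y - (y \<bullet> a) *\<^sub>R a"
  have "?y \<bullet> a = 0"
    using norm_a by (simp add: inner_diff_left dot_square_norm)
  then have "(norm (?y + s *\<^sub>R a))\<^sup>2 = (norm ?y)\<^sup>2 + s\<^sup>2"
    using norm_a by (subst norm_add_Pythagorean) (auto simp: orthogonal_def)
  moreover have "(norm (L (?y + s *\<^sub>R a) + t *\<^sub>R w))\<^sup>2 = (norm (?y + s *\<^sub>R a))\<^sup>2 + t\<^sup>2"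
    using norm_w norm_L orth by (subst norm_add_Pythagorean) (auto simp: orthogonal_def inner_commute)
  moreover have "L (?y + s *\<^sub>R a) = L ?y + s *\<^sub>R L a"
    by (simp only: L.add L.scale)
  ultimately show ?thesis by simp
qed

lemma cylinder_C2_on:
  assumes p: "\<And>s. s \<in> S \<Longrightarrow> (p has_real_derivative p' s) (at s)"
    "\<And>s. s \<in> S \<Longrightarrow> (p' has_real_derivative p'' s) (at s)" "continuous_on S p''"
    and q: "\<And>s. s \<in> S \<Longrightarrow> (q has_real_derivative q' s) (at s)"
    "\<And>s. s \<in> S \<Longrightarrow> (q' has_real_derivative q'' s) (at s)" "continuous_on S q''"
  shows "C2_on {u. u \<bullet> a \<in> S} (cylinder p q)"
proof -
  have "linear (\<lambda>u. L (u - (u \<bullet> a) *\<^sub>R a))"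
    by (intro linearI) (simp_all add: L.add L.diff L.scale algebra_simps inner_add_left)
  then show ?thesis
    unfolding cylinder_def[abs_def]
    by (intro C2_on_add C2_on_bounded_linear C2_on_ridge[OF p] C2_on_ridge[OF q])
      (simp add: linear_conv_bounded_linear)
qed

lemma cylinder_has_derivative:
  assumes p: "(p has_real_derivative p') (at (u \<bullet> a))" and q: "(q has_real_derivative q') (at (u \<bullet> a))"
  shows "(cylinder p q has_derivative
    (\<lambda>h. L (h - (h \<bullet> a) *\<^sub>R a) + (p' * (h \<bullet> a)) *\<^sub>R L a + (q' * (h \<bullet> a)) *\<^sub>R w)) (at u)"
proof -
  have bl: "bounded_linear L"
    using linear_L by (simp add: linear_conv_bounded_linear)
  have chain: "((\<lambda>u. f (u \<bullet> a)) has_derivative (\<lambda>h. f' * (h \<bullet> a))) (at u)"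
    if "(f has_real_derivative f') (at (u \<bullet> a))" for f f'
    using that unfolding has_field_derivative_def
    by (intro has_derivative_compose[where f = "\<lambda>u. u \<bullet> a" and g = f])
      (auto intro!: derivative_eq_intros)
  show ?thesis
    unfolding cylinder_def[abs_def]
    by (intro has_derivative_add has_derivative_scaleR_left chain p q
        bounded_linear.has_derivative[OF bl]) (auto intro!: derivative_eq_intros)
qed

text \<open>A unit-speed curve replaces \<open>L a\<close> by another unit vector of the plane of
  \<open>L a\<close> and \<open>w\<close>, still orthogonal to the image of the complement of
  \<open>a\<close>.\<close>

lemma norm_cylinder_derivative:
  assumes "p'\<^sup>2 + q'\<^sup>2 = 1"
  shows "norm (L (h - (h \<bullet> a) *\<^sub>R a) + (p' * (h \<bullet> a)) *\<^sub>R L a + (q' * (h \<bullet> a)) *\<^sub>R w) = norm h"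
proof -
  have "(p' * (h \<bullet> a))\<^sup>2 + (q' * (h \<bullet> a))\<^sup>2 = (h \<bullet> a)\<^sup>2"
    using assms by (simp add: power_mult_distrib flip: distrib_right)
  moreover have "(norm h)\<^sup>2 = (norm (h - (h \<bullet> a) *\<^sub>R a))\<^sup>2 + (h \<bullet> a)\<^sup>2"
    using norm_frame[of h "h \<bullet> a" 0] by (simp add: norm_L flip: L.scale L.add)
  ultimately show ?thesis
    by - (rule power2_eq_imp_eq, simp_all add: norm_frame)
qed

text \<open>The difference of two values splits into orthogonal parts, which vanish together. Two of
  them give equal points of the curve, hence equal coordinates along \<open>a\<close>; the third
  gives equal components across \<open>a\<close>.\<close>

lemma inj_on_cylinder:
  assumes "inj_on (\<lambda>s. (p s, q s)) S"
  shows "inj_on (cylinder p q) {u. u \<bullet> a \<in> S}"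
proof (rule inj_onI)
  fix u v assume uv: "u \<in> {u. u \<bullet> a \<in> S}" "v \<in> {u. u \<bullet> a \<in> S}" "cylinder p q u = cylinder p q v"
  let ?y = "u - v"
  have "L (?y - (?y \<bullet> a) *\<^sub>R a) + (p (u \<bullet> a) - p (v \<bullet> a)) *\<^sub>R L a + (q (u \<bullet> a) - q (v \<bullet> a)) *\<^sub>R w
      = cylinder p q u - cylinder p q v"
    by (simp add: cylinder_def L.add L.diff L.scale inner_diff_left algebra_simps)
  then have "(norm (?y - (?y \<bullet> a) *\<^sub>R a))\<^sup>2 + (p (u \<bullet> a) - p (v \<bullet> a))\<^sup>2 + (q (u \<bullet> a) - q (v \<bullet> a))\<^sup>2 = 0"
    using uv(3) by (simp flip: norm_frame)
  then have *: "?y - (?y \<bullet> a) *\<^sub>R a = 0" "p (u \<bullet> a) = p (v \<bullet> a)" "q (u \<bullet> a) = q (v \<bullet> a)"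
    by (simp_all add: add_nonneg_eq_0_iff)
  then have "u \<bullet> a = v \<bullet> a"
    using inj_onD[OF assms, of "u \<bullet> a" "v \<bullet> a"] uv by auto
  then show "u = v"
    using *(1) by (simp add: inner_diff_left)
qed

section \<open>Cylinders over the logarithmic spiral\<close>

definition spiral_cylinder :: "real \<Rightarrow> real \<Rightarrow> 'a \<Rightarrow> 'b" where
  "spiral_cylinder b r = cylinder (spiral_x b r) (spiral_y b r)"

lemma C2_on_spiral_cylinder:
  assumes "0 < r"
  shows "C2_on {u. 0 < u \<bullet> a} (spiral_cylinder b r)"
proof -
  have "C2_on {u. u \<bullet> a \<in> {0<..}} (spiral_cylinder b r)"
    unfolding spiral_cylinder_def
    by (rule cylinder_C2_on[OF spiral_x_deriv spiral_x_deriv2 _ spiral_y_deriv spiral_y_deriv2])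
      (use assms in \<open>auto intro!: continuous_intros simp: one_plus_square_neq_0\<close>)
  then show ?thesis by simp
qed

lemma inj_on_spiral_cylinder: "inj_on (spiral_cylinder b r) {u. 0 < u \<bullet> a}"
proof -
  have "inj_on (\<lambda>s. (spiral_x b r s, spiral_y b r s)) {0<..}"
  proof (rule inj_onI)
    fix s t :: real
    assume st: "s \<in> {0<..}" "t \<in> {0<..}" "(spiral_x b r s, spiral_y b r s) = (spiral_x b r t, spiral_y b r t)"
    then have "s\<^sup>2 / (1 + b\<^sup>2) = t\<^sup>2 / (1 + b\<^sup>2)"
      by (simp flip: spiral_radius[of _ r])
    then show "s = t"
      using st by (simp add: one_plus_square_neq_0)
  qed
  from inj_on_cylinder[OF this] show ?thesis
    by (simp add: spiral_cylinder_def)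
qed

lemma surface_isometry_spiral_cylinder:
  assumes "0 < l" "0 < r"
  shows "surface_isometry (slab a l m h) (spiral_cylinder b r)"
proof (rule surface_isometryI)
  let ?D = "\<lambda>u h. L (h - (h \<bullet> a) *\<^sub>R a)
    + ((cos (b * ln (u \<bullet> a / r)) - b * sin (b * ln (u \<bullet> a / r))) / sqrt (1 + b\<^sup>2) * (h \<bullet> a)) *\<^sub>R L a
    + ((sin (b * ln (u \<bullet> a / r)) + b * cos (b * ln (u \<bullet> a / r))) / sqrt (1 + b\<^sup>2) * (h \<bullet> a)) *\<^sub>R w"
  show sub: "slab a l m h \<subseteq> {u. 0 < u \<bullet> a}"
    using assms by (auto simp: slab_def)
  show "open {u. 0 < u \<bullet> a}"
    by (intro open_Collect_less continuous_intros)
  show "inj_on (spiral_cylinder b r) (slab a l m h)"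
    using inj_on_spiral_cylinder sub by (rule inj_on_subset)
  show "(spiral_cylinder b r has_derivative ?D u) (at u)" if "u \<in> slab a l m h" for u
    unfolding spiral_cylinder_def
    using that sub assms by (intro cylinder_has_derivative spiral_x_deriv spiral_y_deriv) auto
  show "norm (?D u h) = norm h" for u h
    by (rule norm_cylinder_derivative[OF spiral_unit_speed])
qed (use assms in \<open>auto simp: convex_slab compact_slab C2_on_spiral_cylinder\<close>)

text \<open>Each spiral coordinate is at most the radius, whence the factor 2. For \<open>b\<close>
  large against \<open>m\<close> the bound is hardly more than \<open>h\<close>, although the slab
  may be long.\<close>

lemma norm_spiral_cylinder_le:
  assumes "u \<in> slab a l m h" "0 < l"
  shows "norm (spiral_cylinder b r u) \<le> h + 2 * (m / sqrt (1 + b\<^sup>2))"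
proof -
  have u: "0 < u \<bullet> a" "u \<bullet> a \<le> m" "norm (u - (u \<bullet> a) *\<^sub>R a) \<le> h"
    using assms by (auto simp: slab_def)
  then have "u \<bullet> a / sqrt (1 + b\<^sup>2) \<le> m / sqrt (1 + b\<^sup>2)"
    using sqrt_one_plus_square_pos[of b] by (simp add: divide_right_mono)
  then have "\<bar>spiral_x b r (u \<bullet> a)\<bar> \<le> m / sqrt (1 + b\<^sup>2)" "\<bar>spiral_y b r (u \<bullet> a)\<bar> \<le> m / sqrt (1 + b\<^sup>2)"
    using abs_spiral_le[of "u \<bullet> a" b r] u by linarith+
  then show ?thesis
    unfolding spiral_cylinder_def cylinder_def using u(3)
    by (intro order_trans[OF norm_triangle_ineq] order_trans[OF add_right_mono[OF norm_triangle_ineq]])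
      (simp add: norm_L norm_w norm_a)
qed

text \<open>After a whole number of turns, counted from \<open>s = r\<close>, the spiral is back on
  the line through \<open>L a\<close>. This is how surfaces with different \<open>b\<close> can
  share points.\<close>

lemma spiral_cylinder_axis:
  assumes "b * ln (s / r) = 2 * pi * real n"
  shows "spiral_cylinder b r (s *\<^sub>R a) = (s / sqrt (1 + b\<^sup>2)) *\<^sub>R L a"
proof -
  have "cos (b * ln (s / r)) = 1" "sin (b * ln (s / r)) = 0"
    unfolding assms using cos_2npi[of n] sin_2npi[of n] by (simp_all add: mult_ac)
  then show ?thesis
    using norm_a
    by (simp add: spiral_cylinder_def cylinder_def spiral_x_def spiral_y_def dot_square_norm L.zero)
qed

end

section \<open>Existence of the frame and of a tight winding\<close>

lemma ex_cylinder_frame: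
  assumes "DIM('a::euclidean_space) < DIM('b::euclidean_space)"
  shows "\<exists>(L :: 'a \<Rightarrow> 'b) w a. cylinder_frame L w a"
proof -
  obtain w :: 'b where w: "norm w = 1"
    using vector_choose_size[of 1] by auto
  obtain a :: 'a where a: "norm a = 1"
    using vector_choose_size[of 1] by auto
  \<comment> \<open>The hyperplane orthogonal to \<open>w\<close> has dimension
    \<open>DIM('b) - 1\<close>, so the strict inequality of the dimensions makes room for
    \<open>L\<close>.\<close>
  have "dim (UNIV :: 'a set) \<le> dim {x. w \<bullet> x = 0}"
    using w assms by (subst dim_hyperplane) auto
  then obtain L where "linear L" "L \<in> UNIV \<rightarrow> {x. w \<bullet> x = 0}" "\<And>x::'a. x \<in> UNIV \<Longrightarrow> norm (L x) = norm x"
    by (rule isometry_subset_subspace[OF subspace_UNIV subspace_hyperplane]) (rule that)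
  with w a have "cylinder_frame L w a"
    unfolding cylinder_frame_def by auto
  then show ?thesis by blast
qed

text \<open>The slab used below has ends in the ratio 2, so \<open>n\<close> counts the full turns
  between them. More turns mean a larger \<open>b\<close>: from \<open>ln 2 \<le> 2 * pi\<close>
  follows \<open>n \<le> b\<close>, and \<open>sqrt (1 + b\<^sup>2)\<close> is at least
  \<open>b\<close>.\<close>

lemma ex_tight_winding:
  fixes \<kappa> :: real
  assumes "0 < \<kappa>"
  obtains b n where "b * ln 2 = 2 * pi * real n" "1 / sqrt (1 + b\<^sup>2) \<le> \<kappa>"
proof -
  obtain n where n: "1 / \<kappa> < real n"
    using reals_Archimedean2 by blast
  define b where "b = 2 * pi * real n / ln 2"
  have "ln 2 \<le> 2 * pi"
    using ln_2_less_1 pi_gt3 by linarith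
  then have "real n \<le> b"
    using mult_left_mono[of "ln 2" "2 * pi" "real n"] by (simp add: b_def field_simps)
  also have "b \<le> sqrt (1 + b\<^sup>2)"
    by (rule real_le_rsqrt) simp
  finally have "1 / \<kappa> < sqrt (1 + b\<^sup>2)"
    using n by linarith
  then have "1 / sqrt (1 + b\<^sup>2) \<le> \<kappa>"
    using assms sqrt_one_plus_square_pos[of b] by (simp add: field_simps)
  then show ?thesis
    by (intro that[of b n]) (auto simp: b_def)
qed

section \<open>The common sample, the two candidate surfaces and the lower bound\<close>

theorem theorem5p7:
  assumes "CARD('k::finite) < CARD('d::finite)"
  shows "\<exists>C::real. C > 0 \<and>
    (\<forall>uh :: real \<Rightarrow> (real ^ 'd) list \<Rightarrow> (real ^ 'k) list. embedding_method uh \<longrightarrow>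
      (\<forall>\<epsilon>::real. \<epsilon> > 0 \<longrightarrow>
        (\<exists>(M :: (real ^ 'd) set) (U :: (real ^ 'k) set) (V :: (real ^ 'k) set)
          (\<phi> :: real ^ 'k \<Rightarrow> real ^ 'd) (xs :: (real ^ 'd) list).
           compact U \<and> convex U \<and> interior U \<noteq> {} \<and>
           open V \<and> U \<subseteq> V \<and> C2_on V \<phi> \<and> surface_isometry U \<phi> \<and>
           M = \<phi> ` U \<and>
           xs \<noteq> [] \<and> distinct xs \<and> set xs \<subseteq> M \<and>
           (SUP x\<in>M. MIN i\<in>{..<length xs}. norm (x - xs ! i)) \<le> \<epsilon> \<and>
           (INF Q\<in>rigid_transformations.
              MAX i\<in>{..<length xs}. norm (uh \<epsilon> xs ! i - Q (inv_into U \<phi> (xs ! i))))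
             \<ge> inverse C * \<epsilon>\<^sup>2)))"
proof (rule exI[of _ 1], intro conjI allI impI)
  fix uh :: "real \<Rightarrow> (real ^ 'd) list \<Rightarrow> (real ^ 'k) list" and \<epsilon> :: real
  assume \<epsilon>: "\<epsilon> > 0"
  have "DIM(real ^ 'k) < DIM(real ^ 'd)"
    using assms by simp
  then obtain L :: "real ^ 'k \<Rightarrow> real ^ 'd" and w a where "cylinder_frame L w a"
    using ex_cylinder_frame by blast
  then interpret cylinder_frame L w a .
  define m where "m = 16 * \<epsilon>\<^sup>2"
  have m: "0 < m"
    using \<epsilon> by (simp add: m_def)
  \<comment> \<open>The bound \<open>1 / 2\<close> separates the two distances;
    \<open>\<epsilon> / (8 * m)\<close> shrinks the outer radius of the spiral to at most
    \<open>\<epsilon> / 8\<close>.\<close>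
  obtain b n where winding: "b * ln 2 = 2 * pi * real n"
    and tight: "1 / sqrt (1 + b\<^sup>2) \<le> min (1 / 2) (\<epsilon> / (8 * m))"
    using ex_tight_winding[of "min (1 / 2) (\<epsilon> / (8 * m))"] \<epsilon> m by auto
  define c where "c = 1 / sqrt (1 + b\<^sup>2)"
  have c: "0 < c" "c \<le> 1 / 2" "c * m \<le> \<epsilon> / 8"
    using tight m sqrt_one_plus_square_pos[of b] by (auto simp: c_def field_simps)
  \<comment> \<open>The sample is fixed before the surface: the method sees only \<epsilon> and
    these points, so \<open>D\<close> is the same for both surfaces.\<close>
  define x1 where "x1 = (c * (m / 2)) *\<^sub>R L a"
  define x2 where "x2 = (c * m) *\<^sub>R L a"
  define D where "D = dist (uh \<epsilon> [x1, x2] ! 0) (uh \<epsilon> [x1, x2] ! 1)"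
  have "L a \<noteq> 0"
    using norm_L[of a] norm_a by auto
  then have "x1 \<noteq> x2"
    using c m by (simp add: x1_def x2_def)
  have norm_x1: "norm x1 \<le> c * m"
    using c m by (simp add: x1_def norm_L norm_a)
  have "4 * \<epsilon>\<^sup>2 \<le> m / 2 - c * m / 2"
    using mult_right_mono[OF c(2), of m] m by (simp add: m_def)
  then consider "2 * \<epsilon>\<^sup>2 \<le> \<bar>D - m / 2\<bar>" | "2 * \<epsilon>\<^sup>2 \<le> \<bar>D - c * m / 2\<bar>"
    by linarith
  \<comment> \<open>One pair of parameters covers both surfaces: \<open>(b, m)\<close> gives the
    spiral and \<open>(0, c * m)\<close> the flat slab. Both have outer radius \<open>c * m\<close>
    and make a whole number of turns.\<close>
  then obtain \<beta> \<mu> j where \<beta>: "\<mu> / sqrt (1 + \<beta>\<^sup>2) = c * m" "\<beta> * ln 2 = 2 * pi * real j"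
    and gap: "2 * \<epsilon>\<^sup>2 \<le> \<bar>D - \<mu> / 2\<bar>"
  proof cases
    case 1
    then show ?thesis
      using winding by (intro that[of m b n]) (simp_all add: c_def)
  next
    case 2
    then show ?thesis
      by (intro that[of "c * m" 0 0]) simp_all
  qed
  have \<mu>: "0 < \<mu>"
  proof -
    have "0 < \<mu> / sqrt (1 + \<beta>\<^sup>2)"
      unfolding \<beta>(1) using c m by simp
    then show ?thesis
      using sqrt_one_plus_square_pos[of \<beta>] by (simp only: zero_less_divide_iff) linarith
  qed
  \<comment> \<open>The half-width \<open>\<epsilon> / 4\<close> is chosen for the covering bound.
    For \<open>k = 1\<close> the ball across \<open>a\<close> is a point and \<open>U\<close> is a
    segment.\<close>
  define U where "U = slab a (\<mu> / 2) \<mu> (\<epsilon> / 4)"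
  \<comment> \<open>The phase \<open>\<mu> / 2\<close> puts the inner end at angle 0, and the outer
    end at \<open>\<beta> * ln 2\<close>, a whole number of turns.\<close>
  define \<phi> where "\<phi> = spiral_cylinder \<beta> (\<mu> / 2)"
  have ends: "(\<mu> / 2) *\<^sub>R a \<in> U" "\<mu> *\<^sub>R a \<in> U"
    using \<mu> \<epsilon> norm_a by (simp_all add: U_def slab_def dot_square_norm)
  have sub: "U \<subseteq> {u. 0 < u \<bullet> a}"
    using \<mu> by (auto simp: U_def slab_def)
  have \<phi>: "\<phi> ((\<mu> / 2) *\<^sub>R a) = x1" "\<phi> (\<mu> *\<^sub>R a) = x2"
    unfolding \<phi>_def
    using \<mu> \<beta> spiral_cylinder_axis[of \<beta> "\<mu> / 2" "\<mu> / 2" 0] spiral_cylinder_axis[of \<beta> \<mu> "\<mu> / 2" j]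
    by (simp_all add: x1_def x2_def)
  have inj: "inj_on \<phi> U"
    unfolding \<phi>_def using inj_on_spiral_cylinder sub by (rule inj_on_subset)
  have inv: "inv_into U \<phi> x1 = (\<mu> / 2) *\<^sub>R a" "inv_into U \<phi> x2 = \<mu> *\<^sub>R a"
    using inv_into_f_f[OF inj ends(1)] inv_into_f_f[OF inj ends(2)] by (simp_all only: \<phi>)
  have "dist ((\<mu> / 2) *\<^sub>R a) (\<mu> *\<^sub>R a) = \<mu> / 2"
    using \<mu> norm_a by (simp add: dist_norm flip: scaleR_left_diff_distrib)
  then have error: "\<epsilon>\<^sup>2 \<le> (INF Q\<in>rigid_transformations. MAX i\<in>{..<length [x1, x2]}.
      norm (uh \<epsilon> [x1, x2] ! i - Q (inv_into U \<phi> ([x1, x2] ! i))))"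
    using gap rigid_fit_error_ge[of "uh \<epsilon> [x1, x2]" "inv_into U \<phi>" x1 x2]
    by (simp add: inv D_def del: length_Cons)
  have cover: "(SUP x\<in>\<phi> ` U. MIN i\<in>{..<length [x1, x2]}. norm (x - [x1, x2] ! i)) \<le> \<epsilon>"
  proof (rule cSUP_least)
    fix x assume "x \<in> \<phi> ` U"
    then obtain u where u: "u \<in> U" "x = \<phi> u" by auto
    \<comment> \<open>The surface and \<open>x1\<close> both lie near the origin: \<open>\<epsilon>
      / 4 + 2 * (\<epsilon> / 8) + \<epsilon> / 8 < \<epsilon>\<close>, so \<open>x1\<close> alone
      covers the surface.\<close>
    have "norm x \<le> \<epsilon> / 4 + 2 * (c * m)"
      using norm_spiral_cylinder_le[of u "\<mu> / 2" \<mu> "\<epsilon> / 4" \<beta> "\<mu> / 2"] u \<mu> \<beta>(1)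
      by (simp add: U_def \<phi>_def)
    then have "norm (x - x1) \<le> \<epsilon>"
      using norm_triangle_ineq4[of x x1] norm_x1 c(3) \<epsilon> by linarith
    moreover have "{..<length [x1, x2]} = {0, 1::nat}"
      by auto
    ultimately show "(MIN i\<in>{..<length [x1, x2]}. norm (x - [x1, x2] ! i)) \<le> \<epsilon>"
      by (simp add: min_def)
  qed (use ends in auto)
  show "\<exists>(M :: (real ^ 'd) set) (U :: (real ^ 'k) set) (V :: (real ^ 'k) set)
          (\<phi> :: real ^ 'k \<Rightarrow> real ^ 'd) (xs :: (real ^ 'd) list).
           compact U \<and> convex U \<and> interior U \<noteq> {} \<and>
           open V \<and> U \<subseteq> V \<and> C2_on V \<phi> \<and> surface_isometry U \<phi> \<and>
           M = \<phi> ` U \<and>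
           xs \<noteq> [] \<and> distinct xs \<and> set xs \<subseteq> M \<and>
           (SUP x\<in>M. MIN i\<in>{..<length xs}. norm (x - xs ! i)) \<le> \<epsilon> \<and>
           (INF Q\<in>rigid_transformations.
              MAX i\<in>{..<length xs}. norm (uh \<epsilon> xs ! i - Q (inv_into U \<phi> (xs ! i))))
             \<ge> inverse 1 * \<epsilon>\<^sup>2"
  proof (intro exI conjI)
    \<comment> \<open>On this half-space the logarithm in the spiral is smooth, so it serves as the
      open domain \<open>V\<close>.\<close>
    show "open {u. 0 < u \<bullet> a}"
      by (intro open_Collect_less continuous_intros)
    show "surface_isometry U \<phi>"
      unfolding U_def \<phi>_def using \<mu> by (simp add: surface_isometry_spiral_cylinder)
    show "C2_on {u. 0 < u \<bullet> a} \<phi>"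
      unfolding \<phi>_def using \<mu> by (simp add: C2_on_spiral_cylinder)
    show "interior U \<noteq> {}"
      unfolding U_def using \<mu> \<epsilon> norm_a by (simp add: interior_slab_nonempty)
    show "distinct [x1, x2]"
      using \<open>x1 \<noteq> x2\<close> by simp
    show "set [x1, x2] \<subseteq> \<phi> ` U"
      using imageI[OF ends(1), of \<phi>] imageI[OF ends(2), of \<phi>] by (simp add: \<phi>)
  qed (use sub error cover in \<open>auto simp: U_def compact_slab convex_slab\<close>)
qed simp

end
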